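(* Let $V$ be a finite set, let $\mathcal{M}=(V,\mathcal{F})$ be a matroid whose maximum independent sets have cardinality $N\ge 1$, and let $f:2^V\to\mathbb{R}$ be strictly increasing with submodularity ratio $\gamma\in(0,1]$ and curvature $\alpha\in[0,1)$. Let $R^*$ be an optimal solution of the problem of minimizing $f(R)$ over all $R\in\mathcal{F}$ with $|R|\ge N$, and let $R^{\mathsf r}$ be the set returned by the reverse greedy algorithm over the matroid. Then $$\frac{f(R^{\mathsf r})-f(\emptyset)}{f(R^* )-f(\emptyset)}\ \le\ \frac{\gamma}{1-\gamma}\Big((2N+1)^{\frac{1-\gamma}{\gamma(1-\alpha)}}-1\Big),$$ where for $\gamma=1$ the right-hand side is read as its limit $\frac{\ln(2N+1)}{1-\alpha}$.
   Context: For $f:2^V\to\mathbb{R}$, $S\subset V$ and $v\in V$, write $\rho_v(S)=f(S\cup\{v\})-f(S)$. The function $f$ is strictly increasing if $f(S_1)<f(S_2)$ whenever $S_1\subsetneq S_2\subset V$. For an increasing $f$: the submodularity ratio is the largest $\gamma\ge 0$ such that $\gamma\,\rho_v(S\cup U)\le \rho_v(S)$ for all $S,U\subset V$, $v\in V\setminus(S\cup U)$; the curvature is the smallest $\alpha\ge 0$ such that $\rho_v(S\cup U)\ge(1-\alpha)\rho_v(S)$ for all $S,U\subset V$, $v\in V\setminus(S\cup U)$ (here $\subset$ allows equality). Both lie in $[0,1]$. A matroid $(V,\mathcal F)$ is given by its collection $\mathcal F$ of independent sets; maximum independent sets are those of largest cardinality. Reverse greedy algorithm over the matroid (it builds up a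 set $R$ of excluded elements): start with $R=\emptyset$, $U=\emptyset$. While $U\ne V$ and $|R|<N$: choose $j\in V\setminus U$ minimizing $\rho_j(R)$ (ties broken arbitrarily); if $R\cup\{j\}\notin\mathcal F$, replace $U$ by $U\cup\{j\}$ and leave $R$ unchanged; otherwise replace both $R$ by $R\cup\{j\}$ and $U$ by $U\cup\{j\}$. Return $R^{\mathsf r}=R$. *)

theory Defs
  imports Complex_Main
begin

(* Matroids are given by their independent sets, on a finite ground set. *)
locale matroid =
  fixes V :: "'a set" and F :: "'a set set"
  assumes finite_ground: "finite V"
    and indep_subset: "F \<subseteq> Pow V"
    and empty_indep: "{} \<in> F"
    and hereditary: "\<lbrakk>B \<in> F; A \<subseteq> B\<rbrakk> \<Longrightarrow> A \<in> F"
    and augmentation: "\<lbrakk>A \<in> F; B \<in> F; card A < card B\<rbrakk> \<Longrightarrow> \<exists>x\<in>B - A. insert x A \<in> F"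

definition marginal :: "('a set \<Rightarrow> real) \<Rightarrow> 'a \<Rightarrow> 'a set \<Rightarrow> real"
  where "marginal f v S = f (S \<union> {v}) - f S"

(* Set functions are total on 'a set; only their values on subsets of V are ever used. *)

definition submodularity_ratio :: "'a set \<Rightarrow> ('a set \<Rightarrow> real) \<Rightarrow> real"
  where "submodularity_ratio V f =
    (GREATEST \<gamma>. 0 \<le> \<gamma> \<and> (\<forall>S U. S \<subseteq> V \<longrightarrow> U \<subseteq> V \<longrightarrow>
      (\<forall>v \<in> V - (S \<union> U). \<gamma> * marginal f v (S \<union> U) \<le> marginal f v S)))"

definition curvature :: "'a set \<Rightarrow> ('a set \<Rightarrow> real) \<Rightarrow> real"
  where "curvature V f =
    (LEAST \<alpha>. 0 \<le> \<alpha> \<and> (\<forall>S U. S \<subseteq> V \<longrightarrow> U \<subseteq> V \<longrightarrow>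
      (\<forall>v \<in> V - (S \<union> U). marginal f v (S \<union> U) \<ge> (1 - \<alpha>) * marginal f v S)))"

(* One iteration of the loop, on states (R, U). Ties in the choice of j are broken
   nondeterministically. *)
inductive reverse_greedy_step ::
    "'a set \<Rightarrow> 'a set set \<Rightarrow> nat \<Rightarrow> ('a set \<Rightarrow> real) \<Rightarrow>
      'a set \<times> 'a set \<Rightarrow> 'a set \<times> 'a set \<Rightarrow> bool"
  for V F N f where
  reject: "\<lbrakk>U \<noteq> V; card R < N; is_arg_min (\<lambda>j. marginal f j R) (\<lambda>j. j \<in> V - U) j;
      R \<union> {j} \<notin> F\<rbrakk>
    \<Longrightarrow> reverse_greedy_step V F N f (R, U) (R, U \<union> {j})"
| accept: "\<lbrakk>U \<noteq> V; card R < N; is_arg_min (\<lambda>j. marginal f j R) (\<lambda>j. j \<in> V - U) j;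
      R \<union> {j} \<in> F\<rbrakk>
    \<Longrightarrow> reverse_greedy_step V F N f (R, U) (R \<union> {j}, U \<union> {j})"

(* R is a possible return value: some run from the initial state ends, with the loop
   condition false, in a state with first component R. *)
definition reverse_greedy_returns ::
    "'a set \<Rightarrow> 'a set set \<Rightarrow> nat \<Rightarrow> ('a set \<Rightarrow> real) \<Rightarrow> 'a set \<Rightarrow> bool"
  where "reverse_greedy_returns V F N f R \<longleftrightarrow>
    (\<exists>U. (reverse_greedy_step V F N f)\<^sup>*\<^sup>* ({}, {}) (R, U) \<and> \<not> (U \<noteq> V \<and> card R < N))"

lemma marginal_pos:
  assumes "strict_mono_on (Pow V) f" "S \<subseteq> V" "v \<in> V - S"
  shows "0 < marginal f v S"
proof -
  have "f S < f (S \<union> {v})"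
    using assms by (intro strict_mono_onD[OF assms(1)]) auto
  then show ?thesis by (simp add: marginal_def)
qed

(* The largest and smallest constants in the two definitions above exist, so GREATEST and
   LEAST are meaningful. *)

lemma submodularity_ratio_props:
  assumes mono: "strict_mono_on (Pow V) f" and ne: "V \<noteq> {}"
  defines "P \<equiv> \<lambda>\<gamma>. 0 \<le> \<gamma> \<and> (\<forall>S U. S \<subseteq> V \<longrightarrow> U \<subseteq> V \<longrightarrow>
      (\<forall>v \<in> V - (S \<union> U). \<gamma> * marginal f v (S \<union> U) \<le> marginal f v S))"
  shows "P (submodularity_ratio V f)"
    and "\<And>\<gamma>. P \<gamma> \<Longrightarrow> \<gamma> \<le> submodularity_ratio V f"
    and "submodularity_ratio V f \<in> {0..1}"
proof -
  obtain v0 where v0: "v0 \<in> V" using ne by blast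
  have P0: "P 0"
    unfolding P_def using marginal_pos[OF mono] by (auto intro: less_imp_le)
  have le1: "\<gamma> \<le> 1" if "P \<gamma>" for \<gamma>
  proof -
    have "\<gamma> * marginal f v0 ({} \<union> {}) \<le> marginal f v0 {}"
      using that v0 unfolding P_def by blast
    moreover have "0 < marginal f v0 {}" using marginal_pos[OF mono, of "{}" v0] v0 by simp
    ultimately show ?thesis by simp
  qed
  have bdd: "bdd_above (Collect P)" by (rule bdd_aboveI[of _ 1]) (auto dest: le1)
  define s where "s = Sup (Collect P)"
  have Ps: "P s"
    unfolding P_def
  proof (intro conjI allI impI ballI)
    show "0 \<le> s" unfolding s_def using P0 bdd by (auto intro: cSup_upper)
  next
    fix S U v assume SU: "S \<subseteq> V" "U \<subseteq> V" and v: "v \<in> V - (S \<union> U)"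
    have pos: "0 < marginal f v (S \<union> U)" using marginal_pos[OF mono _ v] SU by simp
    have "s \<le> marginal f v S / marginal f v (S \<union> U)"
    unfolding s_def
    proof (rule cSup_least)
      fix x assume "x \<in> Collect P"
      then have "x * marginal f v (S \<union> U) \<le> marginal f v S"
        using SU v unfolding P_def by blast
      then show "x \<le> marginal f v S / marginal f v (S \<union> U)" using pos by (simp add: pos_le_divide_eq)
    qed (use P0 in auto)
    then show "s * marginal f v (S \<union> U) \<le> marginal f v S" using pos by (simp add: pos_le_divide_eq)
  qed
  have up: "\<gamma> \<le> s" if "P \<gamma>" for \<gamma> unfolding s_def using that bdd by (auto intro: cSup_upper)
  have eq: "submodularity_ratio V f = s"
    unfolding submodularity_ratio_def P_def[symmetric]
    by (rule Greatest_equality) (use Ps up in auto)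
  show "P (submodularity_ratio V f)" using Ps eq by simp
  show "\<And>\<gamma>. P \<gamma> \<Longrightarrow> \<gamma> \<le> submodularity_ratio V f" using up eq by simp
  show "submodularity_ratio V f \<in> {0..1}" using le1[OF Ps] up[OF P0] eq by simp
qed

lemma curvature_props:
  assumes mono: "strict_mono_on (Pow V) f"
  defines "P \<equiv> \<lambda>\<alpha>. 0 \<le> \<alpha> \<and> (\<forall>S U. S \<subseteq> V \<longrightarrow> U \<subseteq> V \<longrightarrow>
      (\<forall>v \<in> V - (S \<union> U). marginal f v (S \<union> U) \<ge> (1 - \<alpha>) * marginal f v S))"
  shows "P (curvature V f)"
    and "\<And>\<alpha>. P \<alpha> \<Longrightarrow> curvature V f \<le> \<alpha>"
    and "curvature V f \<in> {0..1}"
proof -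
  have P1: "P 1"
    unfolding P_def using marginal_pos[OF mono] by (auto intro: less_imp_le)
  have bdd: "bdd_below (Collect P)" by (rule bdd_belowI[of _ 0]) (auto simp: P_def)
  define s where "s = Inf (Collect P)"
  have Ps: "P s"
    unfolding P_def
  proof (intro conjI allI impI ballI)
    have "Collect P \<noteq> {}" using P1 by blast
    then show "0 \<le> s" unfolding s_def by (rule cInf_greatest) (simp add: P_def)
  next
    fix S U v assume SU: "S \<subseteq> V" "U \<subseteq> V" and v: "v \<in> V - (S \<union> U)"
    have pos: "0 < marginal f v S" using marginal_pos[OF mono, of S v] SU v by simp
    have "1 - marginal f v (S \<union> U) / marginal f v S \<le> s"
    unfolding s_def
    proof (rule cInf_greatest)
      fix x assume "x \<in> Collect P"
      then have "(1 - x) * marginal f v S \<le> marginal f v (S \<union> U)"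
        using SU v unfolding P_def by blast
      then have "1 - x \<le> marginal f v (S \<union> U) / marginal f v S" using pos by (simp add: pos_le_divide_eq)
      then show "1 - marginal f v (S \<union> U) / marginal f v S \<le> x" by simp
    qed (use P1 in auto)
    then have "1 - s \<le> marginal f v (S \<union> U) / marginal f v S" by simp
    then show "(1 - s) * marginal f v S \<le> marginal f v (S \<union> U)" using pos by (simp add: pos_le_divide_eq)
  qed
  have lo: "s \<le> \<alpha>" if "P \<alpha>" for \<alpha> unfolding s_def using that bdd by (auto intro: cInf_lower)
  have eq: "curvature V f = s"
    unfolding curvature_def P_def[symmetric]
    by (rule Least_equality) (use Ps lo in auto)
  show "P (curvature V f)" using Ps eq by simp
  show "\<And>\<alpha>. P \<alpha> \<Longrightarrow> curvature V f \<le> \<alpha>" using lo eq by simp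
  show "curvature V f \<in> {0..1}" using Ps lo[OF P1] eq by (simp add: P_def)
qed

end

theory Submission
  imports Defs
begin

text \<open>
  Because of the exchange property, the elements that the greedy run accepts can be matched with
  the elements of any independent set \<open>I\<close> of the same size: when the run accepts \<open>j\<close> in the state
  \<open>(R, U)\<close>, the set \<open>R\<close> is a maximum independent subset of \<open>U\<close>, so a larger independent set has
  an element \<open>v\<close> outside \<open>U\<close>, and the greedy choice gives \<open>\<rho>\<^sub>j(R) \<le> \<rho>\<^sub>v(R)\<close>.
  The submodularity ratio compares \<open>\<rho>\<^sub>v(R)\<close> with \<open>\<rho>\<^sub>v(\<emptyset>)\<close>. Summing over the run yields
  \<open>\<gamma> (f(R) - f(\<emptyset>)) \<le> (\<Sum>v\<in>I. \<rho>\<^sub>v(\<emptyset>))\<close> (lemma \<open>reverse_greedy_value_le\<close>). In the other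
  direction the curvature gives \<open>(1 - \<alpha>) (\<Sum>v\<in>I. \<rho>\<^sub>v(\<emptyset>)) \<le> f(I) - f(\<emptyset>)\<close>
  (lemma \<open>curvature_sum_singletons_le\<close>). With \<open>I = R\<^sup>*\<close> the ratio in question is at most
  \<open>1 / (\<gamma> (1 - \<alpha>))\<close>, a bound that does not depend on \<open>N\<close>.

  For \<open>N \<ge> 2\<close> this constant is at most the one of the theorem, by comparing
  \<open>(2 * N + 1) powr y \<ge> 5 powr y\<close> with \<open>1 + y + y\<^sup>2\<close>. For \<open>N = 1\<close> it can exceed
  it, since \<open>3 powr (1/2) < 1 + 1/2 + 1/4\<close>. But then the only comparison made is at \<open>R = \<emptyset>\<close>, where
  \<open>\<rho>\<^sub>v(R) = \<rho>\<^sub>v(\<emptyset>)\<close>, so that no factor \<open>\<gamma>\<close> is lost. To treat both cases at once, the greedy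
  bound is stated for any factor \<open>c\<close> with \<open>c \<rho>\<^sub>v(R) \<le> \<rho>\<^sub>v(\<emptyset>)\<close> on the sets \<open>R\<close> that
  occur before the last acceptance.
\<close>

section \<open>Maximality of the greedy set in the elements considered\<close>

context matroid
begin

lemma finite_indep: "A \<in> F \<Longrightarrow> finite A"
  using indep_subset finite_ground by (auto intro: finite_subset)

text \<open>
  The last conjunct says that \<open>U\<close> lies in the matroid closure of \<open>R\<close>. By augmentation it
  survives a rejection: an independent subset of \<open>U \<union> {j}\<close> larger than \<open>R\<close> would supply an
  element extending \<open>R\<close>, and that element is neither in \<open>U\<close> nor equal to \<open>j\<close>.
\<close>
lemma reverse_greedy_step_invariant:
  assumes "reverse_greedy_step V F N f (R, U) (R', U')"
    and "R \<in> F \<and> R \<subseteq> U \<and> U \<subseteq> V \<and> (\<forall>A\<in>F. A \<subseteq> U \<longrightarrow> card A \<le> card R)"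
  shows "R' \<in> F \<and> R' \<subseteq> U' \<and> U' \<subseteq> V \<and> (\<forall>A\<in>F. A \<subseteq> U' \<longrightarrow> card A \<le> card R')"
  using assms(1)
proof cases
  case (reject j)
  have jV: "j \<in> V - U" using reject by (simp add: is_arg_min_def)
  have "card A \<le> card R" if A: "A \<in> F" "A \<subseteq> U \<union> {j}" for A
  proof (rule ccontr)
    assume "\<not> card A \<le> card R"
    then obtain x where x: "x \<in> A - R" "insert x R \<in> F"
      using augmentation[of R A] assms(2) A by auto
    then have "x \<in> U" using A reject by auto
    then have "card (insert x R) \<le> card R" using assms(2) x by blast
    then show False using x assms(2) finite_indep[of R] by auto
  qed
  then show ?thesis using reject assms(2) jV by auto
next
  case (accept j)
  have jV: "j \<in> V - U" using accept by (simp add: is_arg_min_def)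
  have "card A \<le> Suc (card R)" if A: "A \<in> F" "A \<subseteq> U \<union> {j}" for A
  proof -
    have "A - {j} \<in> F" using A(1) by (rule hereditary) auto
    moreover have "A - {j} \<subseteq> U" using A(2) by auto
    ultimately have "card (A - {j}) \<le> card R" using assms(2) by simp
    then show ?thesis by (simp add: card_Diff_singleton_if split: if_splits)
  qed
  moreover have "card (R \<union> {j}) = Suc (card R)"
  proof -
    have "j \<notin> R" using jV assms(2) by blast
    then show ?thesis using assms(2) finite_indep[of R] by simp
  qed
  ultimately show ?thesis using accept assms(2) jV by auto
qed

lemma reverse_greedy_invariant:
  assumes "(reverse_greedy_step V F N f)\<^sup>*\<^sup>* ({}, {}) (R, U)"
  shows "R \<in> F \<and> R \<subseteq> U \<and> U \<subseteq> V \<and> (\<forall>A\<in>F. A \<subseteq> U \<longrightarrow> card A \<le> card R)"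
  using assms
proof (induction rule: rtranclp_induct2)
  case refl
  then show ?case by (simp add: empty_indep)
next
  case (step R U R' U')
  show ?case by (rule reverse_greedy_step_invariant[OF step.hyps(2) step.IH])
qed

lemma reverse_greedy_returns_card_ge:
  assumes "reverse_greedy_returns V F N f R" and "A \<in> F" "card A = N"
  shows "N \<le> card R"
proof -
  obtain U where U: "(reverse_greedy_step V F N f)\<^sup>*\<^sup>* ({}, {}) (R, U)" "U = V \<or> N \<le> card R"
    using assms(1) by (auto simp: reverse_greedy_returns_def)
  then show ?thesis
    using reverse_greedy_invariant[OF U(1)] assms(2,3) indep_subset by blast
qed

section \<open>Comparing marginal gains with singleton gains\<close>

text \<open>
  Quantifying over all independent \<open>I\<close> makes the induction go through without ordering the
  elements of a fixed competitor: the element of \<open>I\<close> found outside \<open>U\<close> is charged with the gain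
  of the accepted element, and the induction hypothesis handles the rest of \<open>I\<close>.
\<close>
lemma reverse_greedy_value_le:
  assumes run: "(reverse_greedy_step V F N f)\<^sup>*\<^sup>* ({}, {}) (R, U)"
    and c0: "0 \<le> c"
    and c: "\<And>S v. \<lbrakk>S \<in> F; card S < N; v \<in> V - S\<rbrakk> \<Longrightarrow> c * marginal f v S \<le> marginal f v {}"
    and "I \<in> F" "card I = card R"
  shows "c * (f R - f {}) \<le> (\<Sum>v\<in>I. marginal f v {})"
  using run assms(4,5)
proof (induction arbitrary: I rule: rtranclp_induct2)
  case refl
  then show ?case using finite_indep[of I] by simp
next
  case (step R U R' U')
  have inv: "R \<in> F" "R \<subseteq> U" "\<forall>A\<in>F. A \<subseteq> U \<longrightarrow> card A \<le> card R"
    using reverse_greedy_invariant[OF step.hyps(1)] by auto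
  from step.hyps(2) show ?case
  proof cases
    case (reject j)
    then show ?thesis using step by simp
  next
    case (accept j)
    have j: "j \<notin> R" using accept inv by (auto simp: is_arg_min_def)
    have cI: "card I = Suc (card R)"
      using step.prems accept j finite_indep[OF inv(1)] by simp
    then have "\<not> I \<subseteq> U" using inv(3) step.prems(1) by fastforce
    then obtain v where v: "v \<in> I" "v \<notin> U" by blast
    have vV: "v \<in> V" using v step.prems indep_subset by blast
    have fin: "finite I" using step.prems finite_indep by blast
    have "f R' - f R = marginal f j R" using accept by (simp add: marginal_def)
    also have "\<dots> \<le> marginal f v R"
      using accept vV v by (auto simp: is_arg_min_def not_less)
    finally have "c * (f R' - f R) \<le> c * marginal f v R" using c0 by (rule mult_left_mono)
    also have "\<dots> \<le> marginal f v {}" using c[of R v] inv v vV accept by auto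
    finally have "c * (f R' - f R) \<le> marginal f v {}" .
    moreover have "c * (f R - f {}) \<le> (\<Sum>u\<in>I - {v}. marginal f u {})"
      using step.IH[of "I - {v}"] hereditary[of I "I - {v}"] step.prems v cI fin by auto
    ultimately show ?thesis
      using sum.remove[OF fin v(1), of "\<lambda>u. marginal f u {}"] by (simp add: algebra_simps)
  qed
qed

end

lemma curvature_sum_singletons_le:
  assumes mono: "strict_mono_on (Pow V) f" and "finite I" "I \<subseteq> V"
  shows "(1 - curvature V f) * (\<Sum>v\<in>I. marginal f v {}) \<le> f I - f {}"
  using assms(2,3)
proof (induction rule: finite_induct)
  case empty
  then show ?case by simp
next
  case (insert x I)
  have "(1 - curvature V f) * marginal f x {} \<le> marginal f x ({} \<union> I)"
    using curvature_props(1)[OF mono, THEN conjunct2, rule_format, of "{}" I x] insert by simp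
  then show ?case using insert by (simp add: marginal_def algebra_simps)
qed

section \<open>Comparison of the constants\<close>

lemma ln_ge_three_halves:
  assumes "5 \<le> (x::real)"
  shows "3/2 \<le> ln x"
proof -
  \<comment> \<open>The bound \<open>exp t \<le> 1 + t + t\<^sup>2\<close> at \<open>t = 1/2\<close> or \<open>t = 1/4\<close> gives only \<open>exp (3/2) \<le> 5.36\<close> or
    \<open>5.12\<close>; at \<open>t = 1/8\<close> it gives \<open>4.85\<close>.\<close>
  have "exp (1/8 :: real) \<le> 73/64"
    using exp_bound[of "1/8 :: real"] by (simp add: power2_eq_square)
  then have "exp (1/8 :: real) ^ 12 \<le> (73/64) ^ 12" by (intro power_mono) auto
  also have "\<dots> \<le> (5::real)" by (simp add: power_divide)
  also have "exp (1/8 :: real) ^ 12 = exp (3/2)" by (simp flip: exp_of_nat_mult)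
  finally have "exp (3/2) \<le> x" using assms by simp
  then show ?thesis using assms ln_ge_iff[of x "3/2"] by simp
qed

text \<open>
  The inequality \<open>exp t \<ge> 1 + t\<close> at \<open>t = (1 - \<gamma>) / \<gamma> * b * ln M\<close>, divided by \<open>(1 - \<gamma>) / \<gamma>\<close>. The left-hand
  side is the limit of the second branch as \<open>\<gamma>\<close> tends to 1.
\<close>
lemma ln_le_greedy_constant:
  fixes \<gamma> b M :: real
  assumes "0 < \<gamma>" "\<gamma> \<le> 1" "0 < M"
  shows "b * ln M \<le> (if \<gamma> = 1 then ln M * b
    else \<gamma> / (1 - \<gamma>) * (M powr ((1 - \<gamma>) / \<gamma> * b) - 1))"
proof (cases "\<gamma> = 1")
  case False
  define x where "x = (1 - \<gamma>) / \<gamma>"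
  have x: "0 < x" using assms False by (simp add: x_def)
  have "x * b * ln M \<le> M powr (x * b) - 1"
  proof -
    have "M powr (x * b) = exp (x * b * ln M)" using assms(3) by (simp add: powr_def)
    then show ?thesis using exp_ge_add_one_self[of "x * b * ln M"] by linarith
  qed
  then have "b * ln M \<le> (M powr (x * b) - 1) / x" using x by (simp add: field_simps)
  then show ?thesis using False by (simp add: x_def field_simps)
qed simp

text \<open>
  Put \<open>x = (1 - \<gamma>) / \<gamma>\<close>, so that \<open>1 / \<gamma> = 1 + x\<close>, and \<open>y = x b\<close>. The claim reads
  \<open>y (1 + x) \<le> M powr y - 1\<close>. Since \<open>b \<ge> 1\<close> we have \<open>x \<le> y\<close>, and \<open>y + y\<^sup>2 \<le> M powr y - 1\<close> follows from
  the quadratic Taylor bound of the exponential as soon as \<open>(ln M)\<^sup>2 \<ge> 2\<close>.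
\<close>
lemma inverse_ratio_le_greedy_constant:
  fixes \<gamma> b M :: real
  assumes "0 < \<gamma>" "\<gamma> \<le> 1" "1 \<le> b" "5 \<le> M"
  shows "b / \<gamma> \<le> (if \<gamma> = 1 then ln M * b
    else \<gamma> / (1 - \<gamma>) * (M powr ((1 - \<gamma>) / \<gamma> * b) - 1))"
proof (cases "\<gamma> = 1")
  case True
  then show ?thesis using ln_ge_three_halves[OF assms(4)] assms(3) by simp
next
  case False
  define x where "x = (1 - \<gamma>) / \<gamma>"
  define y where "y = x * b"
  define z where "z = y * ln M"
  have x: "0 < x" using assms False by (simp add: x_def)
  then have xy: "x \<le> y" using assms by (simp add: y_def)
  have z: "y * (3/2) \<le> z"
    unfolding z_def using ln_ge_three_halves[OF assms(4)] x xy by (intro mult_left_mono) auto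
  have "(y * (3/2))\<^sup>2 \<le> z\<^sup>2" using z x xy by (intro power_mono) auto
  then have "2 * y\<^sup>2 \<le> z\<^sup>2" 
    using zero_le_power2[of y] unfolding power_mult_distrib power_divide power2_eq_square[of 3]
      power2_eq_square[of 2] by linarith
  moreover have "1 + z + z\<^sup>2 / 2 \<le> exp z"
    using z x xy by (intro exp_lower_Taylor_quadratic) auto
  moreover have "y * x \<le> y\<^sup>2" using x xy by (simp add: power2_eq_square mult_left_mono)
  ultimately have "y * (1 + x) \<le> exp z - 1" using z x xy by (simp add: algebra_simps)
  also have "exp z = M powr y" using assms by (simp add: powr_def z_def)
  finally have "b * (1 + x) \<le> (M powr y - 1) / x" using x by (simp add: y_def field_simps)
  moreover have "b * (1 + x) = b / \<gamma>" using assms by (simp add: x_def field_simps)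
  moreover have "(M powr y - 1) / x = \<gamma> / (1 - \<gamma>) * (M powr ((1 - \<gamma>) / \<gamma> * b) - 1)"
    by (simp add: x_def y_def)
  ultimately show ?thesis using False by simp
qed

section \<open>The approximation guarantee\<close>

theorem theorem2:
  fixes V :: "'a set" and F :: "'a set set" and f :: "'a set \<Rightarrow> real"
    and N :: nat and \<gamma> \<alpha> :: real and Rstar Rr :: "'a set"
  assumes "matroid V F"
    and "N = Max (card ` F)" and "N \<ge> 1"
    and "strict_mono_on (Pow V) f"
    and "\<gamma> = submodularity_ratio V f" and "\<gamma> \<in> {0<..1}"
    and "\<alpha> = curvature V f" and "\<alpha> \<in> {0..<1}"
    and "is_arg_min f (\<lambda>R. R \<in> F \<and> card R \<ge> N) Rstar"
    and "reverse_greedy_returns V F N f Rr"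
  shows "(f Rr - f {}) / (f Rstar - f {}) \<le>
    (if \<gamma> = 1 then ln (2 * real N + 1) / (1 - \<alpha>)
     else \<gamma> / (1 - \<gamma>) * ((2 * real N + 1) powr ((1 - \<gamma>) / (\<gamma> * (1 - \<alpha>))) - 1))"
    (is "_ \<le> ?B")
proof -
  interpret matroid V F by fact
  have finF: "finite F" using indep_subset finite_ground by (auto intro: finite_subset)
  have card_le: "card A \<le> N" if "A \<in> F" for A using that finF assms(2) by simp
  have star: "Rstar \<in> F" "card Rstar = N"
    using assms(9) card_le[of Rstar] by (auto simp: is_arg_min_def)
  have star_V: "Rstar \<subseteq> V" "Rstar \<noteq> {}" "finite Rstar"
    using star indep_subset finite_indep assms(3) by auto
  have pos: "0 < f Rstar - f {}"
    using strict_mono_onD[OF assms(4), of "{}" Rstar] star_V by auto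
  obtain U where run: "(reverse_greedy_step V F N f)\<^sup>*\<^sup>* ({}, {}) (Rr, U)"
    using assms(10) by (auto simp: reverse_greedy_returns_def)
  have "Rr \<in> F" using reverse_greedy_invariant[OF run] by blast
  then have card_Rr: "card Rstar = card Rr"
    using reverse_greedy_returns_card_ge[OF assms(10) star] card_le star by (simp add: le_antisym)
  define b where "b = 1 / (1 - \<alpha>)"
  have b: "1 \<le> b" using assms(8) by (simp add: b_def)
  have B: "?B = (if \<gamma> = 1 then ln (2 * real N + 1) * b
      else \<gamma> / (1 - \<gamma>) * ((2 * real N + 1) powr ((1 - \<gamma>) / \<gamma> * b) - 1))"
    by (simp add: b_def)
  have ratio_le: "(f Rr - f {}) / (f Rstar - f {}) \<le> b / c"
    if c0: "0 < c" and
      c: "\<And>S v. \<lbrakk>S \<in> F; card S < N; v \<in> V - S\<rbrakk> \<Longrightarrow> c * marginal f v S \<le> marginal f v {}"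
    for c
  proof -
    have "(1 - \<alpha>) * (c * (f Rr - f {})) \<le> (1 - \<alpha>) * (\<Sum>v\<in>Rstar. marginal f v {})"
      using reverse_greedy_value_le[OF run _ c star(1) card_Rr] c0 assms(8)
      by (intro mult_left_mono) auto
    also have "\<dots> \<le> f Rstar - f {}"
      using curvature_sum_singletons_le[OF assms(4) star_V(3,1)] assms(7) by simp
    finally show ?thesis using pos c0 assms(8) by (simp add: b_def field_simps)
  qed
  show ?thesis
  proof (cases "N = 1")
    case True
    have "(f Rr - f {}) / (f Rstar - f {}) \<le> b / 1"
    proof (rule ratio_le)
      fix S v assume "S \<in> F" "card S < N"
      then have "S = {}" using True finite_indep by auto
      then show "1 * marginal f v S \<le> marginal f v {}" by simp
    qed simp
    also have "\<dots> \<le> b * ln 3"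
    proof -
      have "1 \<le> ln (3::real)" using exp_le by (simp add: ln_ge_iff)
      then show ?thesis using b by simp
    qed
    also have "b * ln 3 \<le> ?B"
    proof -
      have "2 * real N + 1 = 3" using True by simp
      then show ?thesis
        unfolding B by (simp only:) (rule ln_le_greedy_constant, use assms(6) in auto)
    qed
    finally show ?thesis .
  next
    case False
    have "V \<noteq> {}" using star_V by blast
    have "(f Rr - f {}) / (f Rstar - f {}) \<le> b / \<gamma>"
    proof (rule ratio_le)
      fix S v assume "S \<in> F" "v \<in> V - S"
      then have "\<gamma> * marginal f v ({} \<union> S) \<le> marginal f v {}"
        using submodularity_ratio_props(1)[OF assms(4) \<open>V \<noteq> {}\<close>,
            THEN conjunct2, rule_format, of "{}" S v] indep_subset assms(5) by auto
      then show "\<gamma> * marginal f v S \<le> marginal f v {}" by simp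
    qed (use assms(6) in simp)
    also have "\<dots> \<le> ?B"
      unfolding B
      by (rule inverse_ratio_le_greedy_constant) (use assms(3,6) b False in auto)
    finally show ?thesis .
  qed
qed

end
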